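(* If there exists a finite nonempty digraph with no loops, multiple edges or digons that has no satisfactory vertex, then there exist infinitely many pairwise non-isomorphic strongly connected such digraphs (finite, nonempty, with no loops, multiple edges or digons) having no satisfactory vertex.
   Context: A digon is a pair of edges $(u,v),(v,u)$. For a vertex $u$ and positive integer $i$, $N_i(u)=\{v : \mathrm{dist}(u,v)=i\}$, where $\mathrm{dist}(u,v)$ is the length of a shortest directed path from $u$ to $v$ ($\infty$ if none). A vertex $u$ is satisfactory if $|N_1(u)|\le|N_2(u)|$. *)

theory Defs
  imports "Graph_Theory.Graph_Theory" "HOL-Library.Extended_Nat"
begin

definition has_digon :: "('a, 'b) pre_digraph \<Rightarrow> bool" where
  "has_digon G \<longleftrightarrow> (\<exists>u v. u \<rightarrow>\<^bsub>G\<^esub> v \<and> v \<rightarrow>\<^bsub>G\<^esub> u)"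

(* The locale predicate digraph already means finite, loop-free and without multiple arcs. *)
definition oriented_digraph :: "('a, 'b) pre_digraph \<Rightarrow> bool" where
  "oriented_digraph G \<longleftrightarrow> digraph G \<and> verts G \<noteq> {} \<and> \<not> has_digon G"

(* An infimum in enat is a minimum when a path exists, and is infinite over the empty set. *)
definition path_dist :: "('a, 'b) pre_digraph \<Rightarrow> 'a \<Rightarrow> 'a \<Rightarrow> enat" where
  "path_dist G u v = (INF p \<in> {p. pre_digraph.apath G u p v}. enat (length p))"

definition dist_nbhd :: "('a, 'b) pre_digraph \<Rightarrow> nat \<Rightarrow> 'a \<Rightarrow> 'a set" where
  "dist_nbhd G i u = {v \<in> verts G. path_dist G u v = enat i}"

definition satisfactory :: "('a, 'b) pre_digraph \<Rightarrow> 'a \<Rightarrow> bool" where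
  "satisfactory G u \<longleftrightarrow> card (dist_nbhd G 1 u) \<le> card (dist_nbhd G 2 u)"

end

theory Submission
  imports Defs
begin

text \<open>
  Among all sets of vertices reachable from a single vertex, one of minimum cardinality is strongly
  connected and closed under out-neighbours, so both neighbourhoods of each of its vertices
  are the same as in the whole digraph. Replacing every vertex of it by \<open>m\<close> pairwise non-adjacent
  copies multiplies both neighbourhoods by \<open>m\<close>: two copies of one vertex are never at
  distance 2, since there are no digons. The blow-ups for different \<open>m\<close> differ in their
  number of vertices.
\<close>

text \<open>In \<open>enat\<close> the infimum of a nonempty set is attained, and that of the empty
  set is infinite, so a finite value always comes from a shortest path.\<close>

lemma path_dist_eq_enat_iff:
  "path_dist G u v = enat n \<longleftrightarrow>
     (\<exists>p. pre_digraph.apath G u p v \<and> length p = n) \<and>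
     (\<forall>p. pre_digraph.apath G u p v \<longrightarrow> n \<le> length p)" (is "_ \<longleftrightarrow> ?R")
proof
  let ?A = "(\<lambda>p. enat (length p)) ` {p. pre_digraph.apath G u p v}"
  assume "path_dist G u v = enat n"
  then have inf: "Inf ?A = enat n" by (simp add: path_dist_def)
  then have "?A \<noteq> {}" by (metis Inf_enat_def enat.distinct(1) infinity_enat_def)
  then have "Inf ?A \<in> ?A" by (metis Inf_enat_def LeastI ex_in_conv)
  then have "\<exists>p. pre_digraph.apath G u p v \<and> length p = n"
    unfolding inf by auto
  moreover have "n \<le> length p" if "pre_digraph.apath G u p v" for p
  proof -
    have "Inf ?A \<le> enat (length p)" using that by (intro Inf_lower) auto
    then show ?thesis unfolding inf by simp
  qed
  ultimately show ?R by blast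
next
  assume ?R
  then show "path_dist G u v = enat n"
    unfolding path_dist_def
    by (intro antisym INF_greatest) (auto intro: INF_lower2)
qed

context loopfree_digraph
begin

lemma apath_length_0_iff:
  "(\<exists>p. apath u p v \<and> length p = 0) \<longleftrightarrow> u = v \<and> u \<in> verts G"
  by (auto simp: apath_Nil_iff)

lemma apath_length_1_iff:
  "(\<exists>p. apath u p v \<and> length p = 1) \<longleftrightarrow> u \<rightarrow> v"
proof
  assume "\<exists>p. apath u p v \<and> length p = 1"
  then show "u \<rightarrow> v"
    by (auto simp: length_Suc_conv apath_simps arcs_ends_conv)
next
  assume "u \<rightarrow> v"
  then obtain e where "e \<in> arcs G" "tail G e = u" "head G e = v" by blast
  then have "apath u [e] v" using no_loops by (auto simp: apath_simps)
  then show "\<exists>p. apath u p v \<and> length p = 1" by fastforce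
qed

text \<open>Without loops the middle vertex differs from both ends automatically, so distinctness
  along the path reduces to \<open>u \<noteq> v\<close>.\<close>

lemma apath_length_2_iff:
  "(\<exists>p. apath u p v \<and> length p = 2) \<longleftrightarrow> u \<noteq> v \<and> (\<exists>w. u \<rightarrow> w \<and> w \<rightarrow> v)"
proof
  assume "\<exists>p. apath u p v \<and> length p = 2"
  then show "u \<noteq> v \<and> (\<exists>w. u \<rightarrow> w \<and> w \<rightarrow> v)"
    by (auto simp: length_Suc_conv numeral_2_eq_2 apath_simps arcs_ends_conv) blast
next
  assume "u \<noteq> v \<and> (\<exists>w. u \<rightarrow> w \<and> w \<rightarrow> v)"
  then obtain w d e where "u \<noteq> v" "d \<in> arcs G" "tail G d = u" "head G d = w"
    "e \<in> arcs G" "tail G e = w" "head G e = v" by blast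
  then have "apath u [d, e] v" using no_loops by (auto simp: apath_simps)
  then show "\<exists>p. apath u p v \<and> length p = 2" by fastforce
qed

lemma dist_nbhd_1: "dist_nbhd G 1 u = {v. u \<rightarrow> v}"
proof -
  have "path_dist G u v = enat 1 \<longleftrightarrow> u \<rightarrow> v" if "v \<in> verts G" for v
    using apath_length_0_iff[of u v] apath_length_1_iff[of u v] adj_not_same
    unfolding path_dist_eq_enat_iff by (metis One_nat_def Suc_leI neq0_conv)
  then show ?thesis by (auto simp: dist_nbhd_def adj_in_verts)
qed

lemma dist_nbhd_2:
  "dist_nbhd G 2 u = {v. u \<noteq> v \<and> \<not> u \<rightarrow> v \<and> (\<exists>w. u \<rightarrow> w \<and> w \<rightarrow> v)}"
proof -
  have "path_dist G u v = enat 2 \<longleftrightarrow>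
      u \<noteq> v \<and> \<not> u \<rightarrow> v \<and> (\<exists>w. u \<rightarrow> w \<and> w \<rightarrow> v)" if "v \<in> verts G" for v
  proof -
    have "2 \<le> n \<longleftrightarrow> n \<noteq> 0 \<and> n \<noteq> 1" for n :: nat by auto
    then show ?thesis
      using that apath_length_0_iff[of u v] apath_length_1_iff[of u v] apath_length_2_iff[of u v]
      unfolding path_dist_eq_enat_iff by metis
  qed
  then show ?thesis by (auto simp: dist_nbhd_def adj_in_verts)
qed

end

text \<open>Moving from \<open>u\<close> to some \<open>v\<close> in \<open>R u\<close> can only
  shrink the reachable set. If \<open>R u\<close> has least cardinality, then
  \<open>R v = R u\<close>, so \<open>v\<close> reaches all of \<open>R u\<close>.\<close>

lemma (in fin_digraph) ex_strongly_connected_closed_set: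
  assumes "verts G \<noteq> {}"
  obtains W where "W \<subseteq> verts G" "W \<noteq> {}" "\<And>v w. v \<in> W \<Longrightarrow> v \<rightarrow> w \<Longrightarrow> w \<in> W"
    "\<And>v w. v \<in> W \<Longrightarrow> w \<in> W \<Longrightarrow> v \<rightarrow>\<^sup>* w"
proof -
  define R where "R u = {v. u \<rightarrow>\<^sup>* v}" for u
  have R_sub: "R u \<subseteq> verts G" for u by (auto simp: R_def reachable_in_verts)
  obtain u where u: "u \<in> verts G" and min: "\<And>v. v \<in> verts G \<Longrightarrow> card (R u) \<le> card (R v)"
    using arg_min_if_finite(1)[OF finite_verts assms, of "\<lambda>v. card (R v)"]
      arg_min_least[OF finite_verts assms, of _ "\<lambda>v. card (R v)"]
    by blast
  have "R v = R u" if "v \<in> R u" for v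
  proof (rule card_subset_eq)
    show "finite (R u)" using R_sub finite_verts finite_subset by blast
    show sub: "R v \<subseteq> R u" using that by (auto simp: R_def intro: reachable_trans)
    have "card (R u) \<le> card (R v)" using min R_sub that by blast
    then show "card (R v) = card (R u)"
      using card_mono[OF \<open>finite (R u)\<close> sub] by simp
  qed
  then have "v \<rightarrow>\<^sup>* w" if "v \<in> R u" "w \<in> R u" for v w
    using that by (auto simp: R_def)
  moreover have "w \<in> R u" if "v \<in> R u" "v \<rightarrow> w" for v w
    using that by (auto simp: R_def intro: reachable_adj_trans)
  moreover have "R u \<noteq> {}" using u by (auto simp: R_def)
  ultimately show thesis using that[of "R u"] R_sub by blast
qed

text \<open>Vertices with the same image under \<open>p\<close> act as copies of one vertex, so this
  is a blow-up whose copies may be coded in any type. Taking pairs as arcs excludes multiple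
  arcs.\<close>

definition pullback_digraph ::
    "('c \<Rightarrow> 'a) \<Rightarrow> 'c set \<Rightarrow> ('a, 'b) pre_digraph \<Rightarrow> ('c, 'c \<times> 'c) pre_digraph" where
  "pullback_digraph p V G =
     \<lparr>verts = V, arcs = {(x, y). x \<in> V \<and> y \<in> V \<and> p x \<rightarrow>\<^bsub>G\<^esub> p y}, tail = fst, head = snd\<rparr>"

lemma verts_pullback_digraph [simp]: "verts (pullback_digraph p V G) = V"
  by (simp add: pullback_digraph_def)

lemma pullback_digraph_adj_iff [simp]:
  "x \<rightarrow>\<^bsub>pullback_digraph p V G\<^esub> y \<longleftrightarrow> x \<in> V \<and> y \<in> V \<and> p x \<rightarrow>\<^bsub>G\<^esub> p y"
  by (auto simp: pullback_digraph_def arcs_ends_conv image_iff)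

lemma oriented_pullback_digraph:
  assumes "oriented_digraph G" "finite V" "V \<noteq> {}"
  shows "oriented_digraph (pullback_digraph p V G)"
proof -
  interpret digraph G using assms by (simp add: oriented_digraph_def)
  have "finite {(x, y). x \<in> V \<and> y \<in> V \<and> p x \<rightarrow>\<^bsub>G\<^esub> p y}"
    by (rule finite_subset[of _ "V \<times> V"]) (use assms in auto)
  then have "digraph (pullback_digraph p V G)"
    using assms(2) adj_not_same
    by unfold_locales (auto simp: pullback_digraph_def arc_to_ends_def)
  then show ?thesis
    using assms unfolding oriented_digraph_def has_digon_def by auto
qed

text \<open>Adjacency depends only on images under \<open>p\<close>, so a nonempty walk in
  \<open>G\<close> lifts from any chosen copy of its start to any chosen copy of its end.\<close>

lemma strongly_connected_pullback_digraph:
  assumes "oriented_digraph G" "finite V" "V \<noteq> {}"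
    and closed: "\<And>v w. v \<in> p ` V \<Longrightarrow> v \<rightarrow>\<^bsub>G\<^esub> w \<Longrightarrow> w \<in> p ` V"
    and conn: "\<And>v w. v \<in> p ` V \<Longrightarrow> w \<in> p ` V \<Longrightarrow> v \<rightarrow>\<^sup>*\<^bsub>G\<^esub> w"
    and out: "\<And>v. v \<in> p ` V \<Longrightarrow> \<exists>w. v \<rightarrow>\<^bsub>G\<^esub> w"
  shows "strongly_connected (pullback_digraph p V G)"
proof -
  let ?H = "pullback_digraph p V G"
  interpret G: digraph G using assms by (simp add: oriented_digraph_def)
  interpret H: digraph ?H
    using oriented_pullback_digraph[OF assms(1-3)] by (simp add: oriented_digraph_def)
  \<comment> \<open>The induction carries the first conjunct to supply some copy \<open>z\<close> of
    the previous vertex; the last arc may then end at any copy of \<open>w\<close>.\<close>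
  have lift: "w \<in> p ` V \<and> (\<forall>y \<in> V. p y = w \<longrightarrow> x \<rightarrow>\<^sup>*\<^bsub>?H\<^esub> y)"
    if "x \<in> V" "p x \<rightarrow>\<^sup>+\<^bsub>G\<^esub> w" for x w
    using that(2)
  proof (induction rule: trancl_induct)
    case (base w)
    then show ?case using that(1) closed by auto
  next
    case (step v w)
    then obtain z where z: "z \<in> V" "p z = v" "x \<rightarrow>\<^sup>*\<^bsub>?H\<^esub> z" by blast
    have "x \<rightarrow>\<^sup>*\<^bsub>?H\<^esub> y" if "y \<in> V" "p y = w" for y
      using z step.hyps(2) that by (intro H.reachable_adj_trans[OF z(3)]) auto
    then show ?case using closed step by blast
  qed
  have "x \<rightarrow>\<^sup>*\<^bsub>?H\<^esub> y" if "x \<in> V" "y \<in> V" for x y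
  proof -
    \<comment> \<open>Going through \<open>w\<close> also covers two copies of one vertex, where the empty walk does not lift.\<close>
    have px: "p x \<in> p ` V" and py: "p y \<in> p ` V" using that by simp_all
    obtain w where w: "p x \<rightarrow>\<^bsub>G\<^esub> w" using out[OF px] by (rule exE)
    have "w \<rightarrow>\<^sup>*\<^bsub>G\<^esub> p y" by (rule conn[OF closed[OF px w] py])
    with w have "p x \<rightarrow>\<^sup>+\<^bsub>G\<^esub> p y"
      by (intro G.reachable1_reachable_trans[OF r_into_trancl])
    then show ?thesis using lift that by blast
  qed
  then show ?thesis using assms(3) by (auto simp: strongly_connected_def)
qed

text \<open>Both neighbourhoods are full preimages, which makes their sizes computable from the
  fibres of \<open>p\<close>.\<close>

lemma dist_nbhd_pullback_digraph:
  assumes "oriented_digraph G" "finite V"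
    and closed: "\<And>v w. v \<in> p ` V \<Longrightarrow> v \<rightarrow>\<^bsub>G\<^esub> w \<Longrightarrow> w \<in> p ` V"
    and x: "x \<in> V"
  shows "dist_nbhd (pullback_digraph p V G) 1 x = {y \<in> V. p y \<in> dist_nbhd G 1 (p x)}"
    and "dist_nbhd (pullback_digraph p V G) 2 x = {y \<in> V. p y \<in> dist_nbhd G 2 (p x)}"
proof -
  let ?H = "pullback_digraph p V G"
  interpret G: digraph G using assms by (simp add: oriented_digraph_def)
  interpret H: digraph ?H
    using oriented_pullback_digraph[OF assms(1,2)] x by (auto simp: oriented_digraph_def)
  \<comment> \<open>If \<open>y \<noteq> x\<close> but \<open>p y = p x\<close>, a path of length 2
    from \<open>x\<close> to \<open>y\<close> would project to a digon.\<close>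
  have nodig: "\<not> (v \<rightarrow>\<^bsub>G\<^esub> w \<and> w \<rightarrow>\<^bsub>G\<^esub> v)" for v w
    using assms(1) by (auto simp: oriented_digraph_def has_digon_def)
  show "dist_nbhd ?H 1 x = {y \<in> V. p y \<in> dist_nbhd G 1 (p x)}"
    using x by (auto simp: G.dist_nbhd_1[simplified] H.dist_nbhd_1[simplified])
  \<comment> \<open>Closedness guarantees that each middle vertex in \<open>G\<close> has a copy in
    \<open>V\<close>.\<close>
  have mid: "(\<exists>z \<in> V. p x \<rightarrow>\<^bsub>G\<^esub> p z \<and> p z \<rightarrow>\<^bsub>G\<^esub> v) \<longleftrightarrow> (\<exists>w. p x \<rightarrow>\<^bsub>G\<^esub> w \<and> w \<rightarrow>\<^bsub>G\<^esub> v)" for v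
    using closed x by blast
  show "dist_nbhd ?H 2 x = {y \<in> V. p y \<in> dist_nbhd G 2 (p x)}"
    using x mid nodig by (auto simp: G.dist_nbhd_2 H.dist_nbhd_2) metis+
qed

lemma digraph_iso_card_verts: "digraph_iso G H \<Longrightarrow> card (verts H) = card (verts G)"
  by (auto simp: digraph_iso_def pre_digraph.digraph_isomorphism_def card_image)

theorem theorem4:
  assumes "\<exists>G :: ('a, 'b) pre_digraph.
    oriented_digraph G \<and> \<not> (\<exists>u \<in> verts G. satisfactory G u)"
  shows "\<exists>S :: (nat, nat \<times> nat) pre_digraph set.
    infinite S \<and>
    (\<forall>H \<in> S. oriented_digraph H \<and> strongly_connected H \<and>
       \<not> (\<exists>u \<in> verts H. satisfactory H u)) \<and>
    (\<forall>H \<in> S. \<forall>K \<in> S. H \<noteq> K \<longrightarrow> \<not> digraph_iso H K)"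
proof -
  obtain G :: "('a, 'b) pre_digraph" where G: "oriented_digraph G"
    and unsat: "\<And>u. u \<in> verts G \<Longrightarrow> card (dist_nbhd G 2 u) < card (dist_nbhd G 1 u)"
    using assms by (auto simp: satisfactory_def not_le)
  interpret G: digraph G using G by (simp add: oriented_digraph_def)
  obtain W where W: "W \<subseteq> verts G" "W \<noteq> {}"
    and closed: "\<And>v w. v \<in> W \<Longrightarrow> v \<rightarrow>\<^bsub>G\<^esub> w \<Longrightarrow> w \<in> W"
    and conn: "\<And>v w. v \<in> W \<Longrightarrow> w \<in> W \<Longrightarrow> v \<rightarrow>\<^sup>*\<^bsub>G\<^esub> w"
    using G G.ex_strongly_connected_closed_set by (metis oriented_digraph_def)
  have "finite W" using W(1) G.finite_verts finite_subset by blast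
  then obtain f :: "'a \<Rightarrow> nat" where f: "inj_on f W"
    using finite_imp_inj_to_nat_seg by metis
  \<comment> \<open>The pair \<open>(f w, i)\<close>, coded as a natural number, is copy
    \<open>i\<close> of \<open>w\<close>, and \<open>p\<close> recovers \<open>w\<close>. As
    \<open>i\<close> ranges over \<open>{..m}\<close>, there are \<open>Suc m\<close> copies, never
    zero.\<close>
  define p where "p x = the_inv_into W f (fst (prod_decode x))" for x
  define V where "V m = prod_encode ` (f ` W \<times> {..m})" for m :: nat
  define H where "H m = pullback_digraph p (V m) G" for m
  have V_nonempty: "V m \<noteq> {}" for m using W(2) by (auto simp: V_def)
  have V_finite: "finite (V m)" for m using \<open>finite W\<close> by (auto simp: V_def)
  have p_encode: "p (prod_encode (f w, i)) = w" if "w \<in> W" for w i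
    using that f by (simp add: p_def the_inv_into_f_f)
  have p_image: "p ` V m = W" for m
    by (force simp: V_def p_encode image_iff)
  have fibres: "card {y \<in> V m. p y \<in> A} = card A * Suc m" if "A \<subseteq> W" for A m
  proof -
    have "{y \<in> V m. p y \<in> A} = prod_encode ` (f ` A \<times> {..m})"
      using that by (auto simp: V_def p_encode)
    moreover have "card (f ` A) = card A"
      using f that by (meson card_image inj_on_subset)
    ultimately show ?thesis
      by (simp add: card_image inj_prod_encode card_cartesian_product)
  qed
  have card_V: "card (V m) = card W * Suc m" for m
  proof -
    have "{y \<in> V m. p y \<in> W} = V m" using p_image by blast
    then show ?thesis using fibres[of W m] by simp
  qed
  \<comment> \<open>A vertex without out-neighbours would be satisfactory, its first neighbourhood
    being empty.\<close>
  have out: "\<exists>w. v \<rightarrow>\<^bsub>G\<^esub> w" if "v \<in> W" for v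
  proof -
    have "card {w. v \<rightarrow>\<^bsub>G\<^esub> w} \<noteq> 0" using unsat[of v] that W(1) G.dist_nbhd_1[of v] by auto
    then show ?thesis by (metis (mono_tags) Collect_empty_eq card.empty)
  qed
  \<comment> \<open>Closedness keeps both neighbourhoods inside \<open>W\<close>, so
    \<open>fibres\<close> scales each by the same positive factor \<open>Suc m\<close> and the
    strict inequality survives.\<close>
  have unsat_H: "\<not> satisfactory (H m) x" if x: "x \<in> V m" for m x
  proof -
    have px: "p x \<in> W" using p_image x by blast
    have "dist_nbhd G 1 (p x) \<subseteq> W" "dist_nbhd G 2 (p x) \<subseteq> W"
      using px closed unfolding G.dist_nbhd_1 G.dist_nbhd_2 by blast+
    moreover have "card (dist_nbhd G 2 (p x)) < card (dist_nbhd G 1 (p x))"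
      using px W(1) unsat by blast
    ultimately show ?thesis
      using dist_nbhd_pullback_digraph[OF G V_finite[of m] _ x, of p] closed
      unfolding satisfactory_def H_def p_image by (simp add: fibres del: One_nat_def mult_Suc_right)
  qed
  \<comment> \<open>Since \<open>W\<close> is finite and nonempty, the factor \<open>card W\<close>
    cancels. This yields both the injectivity of \<open>H\<close> and the absence of
    isomorphisms.\<close>
  have iso_eq: "m = n" if "card (V m) = card (V n)" for m n
    using that card_V W(2) \<open>finite W\<close> by auto
  have "inj H"
    by (rule injI) (metis H_def iso_eq verts_pullback_digraph)
  then have "infinite (range H)" by (simp add: finite_image_iff)
  moreover have "oriented_digraph (H m)" for m
    unfolding H_def by (rule oriented_pullback_digraph[OF G V_finite V_nonempty])
  moreover have "strongly_connected (H m)" for m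
    unfolding H_def
    by (rule strongly_connected_pullback_digraph[OF G V_finite V_nonempty];
        unfold p_image; fact closed conn out)
  moreover have "\<not> digraph_iso (H m) (H n)" if "H m \<noteq> H n" for m n
    using that iso_eq[of m n] digraph_iso_card_verts[of "H m" "H n"] by (auto simp: H_def)
  moreover have "verts (H m) = V m" for m by (simp add: H_def)
  ultimately show ?thesis
    using unsat_H by (intro exI[of _ "range H"]) auto
qed

end
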